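(* Let $p$ be a prime, let $m < n$, and let $L : \mathbb{F}_p^n \to \mathbb{F}_p^m$ be an $\mathbb{F}_p$-linear map of rank $m$. Let $v$ be a nonzero vector in $\ker(L)$ with minimal support, and let $s = |\mathrm{supp}(v)|$ be the size of its support. Let $k \geq 1$ be an integer with $p \geq 2k-1$. Then for all subsets $A_1, \ldots, A_n \subseteq \mathbb{F}_p$ with $|A_i| = k$ for all $i \le n$, we have $$ |L(A_1, \ldots, A_n)| \geq \left(k^{s} - (k-1)^{s} \right) \cdot k^{m-s+1}.$$
   Context: $\mathbb{F}_p$ is the field of integers modulo the prime $p$. For $v \in \mathbb{F}_p^n$, $\mathrm{supp}(v) = \{ i \in \{1,\ldots,n\} \mid v_i \neq 0\}$. "Minimal support" means that no nonzero vector of $\ker(L)$ has support strictly contained in $\mathrm{supp}(v)$ (in this case $s \le m+1$, so the exponent $m-s+1$ is nonnegative). For subsets $A_1,\ldots,A_n \subseteq \mathbb{F}_p$, $L(A_1, \ldots, A_n) = \{ L(a_1, \ldots, a_n) \mid a_i \in A_i \text{ for each } i \}$, i.e. the image of $A_1 \times \cdots \times A_n$ under $L$. *)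

theory Defs
  imports "Jordan_Normal_Form.VS_Connect" "Berlekamp_Zassenhaus.Finite_Field"
begin

text \<open>Coordinates are indexed by \<open>{0..<n}\<close> instead of \<open>{1..n}\<close>.  The field with \<open>p\<close> elements is
  \<open>'p mod_ring\<close> with \<open>'p :: prime_card\<close>, where \<open>p = CARD('p)\<close>.\<close>

definition vec_supp :: "'a :: zero vec \<Rightarrow> nat set" where
  "vec_supp v = {i. i < dim_vec v \<and> v $ i \<noteq> 0}"

definition map_rank ::
  "nat \<Rightarrow> nat \<Rightarrow> ('a :: field vec \<Rightarrow> 'a vec) \<Rightarrow> nat" where
  "map_rank n m L = vectorspace.dim class_ring
     ((module_vec TYPE('a) m)
       \<lparr>carrier := mod_hom.im (module_vec TYPE('a) n) L\<rparr>)"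

definition map_kernel ::
  "nat \<Rightarrow> nat \<Rightarrow> ('a :: field vec \<Rightarrow> 'a vec) \<Rightarrow> 'a vec set" where
  "map_kernel n m L = mod_hom.ker (module_vec TYPE('a) n) (module_vec TYPE('a) m) L"

definition has_minimal_support :: "'a :: zero vec set \<Rightarrow> 'a vec \<Rightarrow> bool" where
  "has_minimal_support K v \<longleftrightarrow>
     \<not> (\<exists>w\<in>K. w \<noteq> 0\<^sub>v (dim_vec w) \<and> vec_supp w \<subset> vec_supp v)"

definition vec_box :: "nat \<Rightarrow> (nat \<Rightarrow> 'a set) \<Rightarrow> 'a vec set" where
  "vec_box n A = {a \<in> carrier_vec n. \<forall>i<n. a $ i \<in> A i}"

end

theory Submission
  imports Defs "Berlekamp_Zassenhaus.Berlekamp_Type_Based"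
begin

text \<open>Counting the values of \<open>L\<close> on a box means counting the classes modulo the kernel that meet the box.  The proof
reduces to a kernel that is a line and then counts by slicing, with the Cauchy--Davenport
inequality as the one-dimensional input.

\<^emph>\<open>Reduction.\<close>  Let \<open>l\<close> be in the support \<open>S\<close> of \<open>v\<close>.  By minimality of the support the columns of \<open>L\<close>
indexed by \<open>S - {l}\<close> are linearly independent, so they extend to independent columns indexed by
a set \<open>J\<close> of size at least \<open>m\<close> (\<open>independent_coordinates_extend\<close>).  Fix the coordinates outside
\<open>insert l J\<close>.  On the remaining ones the kernel of \<open>L\<close> is the line spanned by \<open>v\<close>, and each class modulo
this line has a unique representative with coordinate \<open>l\<close> equal to 0.  The classes that meet the box
are therefore the points of \<open>\<Union>t\<in>A l. \<Prod>j\<in>J. (A j - (v\<^sub>j / v\<^sub>l) t)\<close>, a union of translates of one box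
(\<open>card_shifted_boxes_le_card_linear_image\<close>).

\<^emph>\<open>Counting.\<close>  Add the coordinates of the box one at a time.  The points whose last coordinate is \<open>x\<close>
form a union of lower-dimensional boxes over those \<open>t\<close> for which \<open>x\<close> lies in the translated last side,
and the inductive lower bound for it is affine in the number of these \<open>t\<close>.  Summing over \<open>x\<close>
therefore requires only two numbers: the total number of pairs \<open>(x, t)\<close>, which is exact, and the number of
distinct \<open>x\<close>, which is the size of a sumset (\<open>card_union_of_boxes\<close>).  The Cauchy--Davenport inequality
\<open>|X + Y| \<ge> |X| + |Y| - 1\<close> bounds the latter; \<open>p \<ge> 2k - 1\<close> is what makes it available for sets
of at most \<open>k\<close> elements.  If all nonzero coordinates of \<open>v\<close> are equal and all \<open>A i\<close> are the interval \<open>{0..<k}\<close>, then all these steps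
are equalities, which explains
why the recursion returns precisely \<open>k\<^sup>s - (k - 1)\<^sup>s\<close>: among the points of a cube of side \<open>k\<close>
it counts those that have some coordinate at its least value.\<close>

section \<open>Counting unions of boxes\<close>

text \<open>The counting heart of the argument.  Any subfamily \<open>T'\<close> of the sets \<open>B j t\<close> in a single direction \<open>j\<close>
is assumed to have a union of at least \<open>c j + e j * (card T' - 1)\<close> elements; the conclusion
is that the boxes spread as if every growth were exact.  Slice the union of boxes by the value \<open>x\<close>
of one coordinate \<open>r\<close>: the slice is the union of the lower-dimensional boxes over the indices \<open>t\<close>
with \<open>x \<in> B r t\<close>.  The bound given by induction for the slice is affine in the number of such \<open>t\<close>.
Summed over \<open>x\<close>, those numbers add up to \<open>c r * card T\<close> by double counting, while the constant
term is counted once per \<open>x\<close>, that is, \<open>card (\<Union>t\<in>T. B r t)\<close> times; this is where the growth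
in direction \<open>r\<close> enters.  The induction needs the growth hypothesis for every nonempty
subset of \<open>T\<close> because the indices that survive in a slice are arbitrary.\<close>

lemma card_union_of_boxes:
  fixes B :: "'i \<Rightarrow> 't \<Rightarrow> 'b set" and c e :: "'i \<Rightarrow> nat"
  assumes "finite J"
    and "finite T" and "T \<noteq> {}"
    and fin: "\<And>j t. j \<in> J \<Longrightarrow> t \<in> T \<Longrightarrow> finite (B j t)"
    and card: "\<And>j t. j \<in> J \<Longrightarrow> t \<in> T \<Longrightarrow> card (B j t) = c j"
    and e: "\<And>j. j \<in> J \<Longrightarrow> e j \<le> c j"
    and growth: "\<And>j T'. j \<in> J \<Longrightarrow> T' \<subseteq> T \<Longrightarrow> T' \<noteq> {} \<Longrightarrow>
      c j + e j * (card T' - 1) \<le> card (\<Union>t\<in>T'. B j t)"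
  shows "(\<Prod>j\<in>J. c j) + ((\<Prod>j\<in>J. c j) - (\<Prod>j\<in>J. c j - e j)) * (card T - 1)
    \<le> card (\<Union>t\<in>T. \<Pi>\<^sub>E j\<in>J. B j t)"
  using assms
proof (induction J arbitrary: T rule: finite_induct)
  case empty
  then show ?case by simp
next
  case (insert r J)
  define K where "K = (\<Prod>j\<in>J. c j)"
  define K' where "K' = (\<Prod>j\<in>J. c j - e j)"
  define X where "X = (\<Union>t\<in>T. B r t)"
  define F where "F x = {t \<in> T. x \<in> B r t}" for x
  define U where "U S = (\<Union>t\<in>S. \<Pi>\<^sub>E j\<in>J. B j t)" for S
  have "K' \<le> K"
    unfolding K_def K'_def by (intro prod_mono) auto
  have er: "e r \<le> c r" by (simp add: insert.prems)
  have finX: "finite X"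
    unfolding X_def using insert.prems by auto
  have finU: "finite (U S)" if "S \<subseteq> T" for S
    unfolding U_def using that insert.prems insert.hyps finite_subset[OF that]
    by (intro finite_UN_I finite_PiE) auto
  have fibre: "K + (K - K') * (card (F x) - 1) \<le> card (U (F x))" if "x \<in> X" for x
    unfolding K_def K'_def U_def
  proof (rule insert.IH)
    show "finite (F x)" "F x \<noteq> {}"
      using that \<open>finite T\<close> by (auto simp: F_def X_def)
  next
    fix j T' assume "j \<in> J" "T' \<subseteq> F x" "T' \<noteq> {}"
    then show "c j + e j * (card T' - 1) \<le> card (\<Union> (B j ` T'))"
      using insert.prems(6)[of j T'] by (auto simp: F_def)
  qed (use insert.prems in \<open>auto simp: F_def\<close>)
  \<comment> \<open>Slicing by the coordinate \<open>r\<close>: the slice over \<open>x\<close> is \<open>U (F x)\<close>.\<close>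
  have "(\<Union>t\<in>T. \<Pi>\<^sub>E j\<in>insert r J. B j t) = (\<lambda>(x, g). g(r := x)) ` (SIGMA x:X. U (F x))"
    unfolding PiE_insert_eq by (fastforce simp: X_def F_def U_def image_iff)
  moreover have "inj_on (\<lambda>(x, g). g(r := x)) (SIGMA x:X. U (F x))"
  proof (rule inj_onI, clarify)
    fix x g y h
    assume g: "g \<in> U (F x)" and h: "h \<in> U (F y)" and eq: "g(r := x) = h(r := y)"
    have "g r = h r"
      using g h \<open>r \<notin> J\<close> by (auto simp: U_def PiE_def extensional_def)
    with eq show "x = y \<and> g = h"
      by (metis fun_upd_same fun_upd_triv fun_upd_upd)
  qed
  ultimately have "card (\<Union>t\<in>T. \<Pi>\<^sub>E j\<in>insert r J. B j t) = (\<Sum>x\<in>X. card (U (F x)))"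
    using finX finU by (simp add: card_image F_def)
  \<comment> \<open>The inductive bound, rewritten without the truncated subtraction since \<open>F x\<close> is nonempty.\<close>
  moreover have "(\<Sum>x\<in>X. K' + (K - K') * card (F x)) \<le> (\<Sum>x\<in>X. card (U (F x)))"
  proof (rule sum_mono)
    fix x assume x: "x \<in> X"
    then have "card (F x) > 0"
      using \<open>finite T\<close> by (auto simp: F_def X_def card_gt_0_iff)
    then obtain q where q: "card (F x) = Suc q"
      using gr0_implies_Suc by blast
    show "K' + (K - K') * card (F x) \<le> card (U (F x))"
      using fibre[OF x] \<open>K' \<le> K\<close> by (simp add: q)
  qed
  moreover have "(\<Sum>x\<in>X. card (F x)) = c r * card T"
  proof -
    have "(\<Sum>x\<in>X. card (F x)) = (\<Sum>t\<in>T. card {x \<in> X. x \<in> B r t})"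
      unfolding F_def using finX \<open>finite T\<close> by (intro sum_multicount_gen) auto
    also have "\<dots> = (\<Sum>t\<in>T. c r)"
    proof (rule sum.cong)
      fix t assume t: "t \<in> T"
      then have "{x \<in> X. x \<in> B r t} = B r t" by (auto simp: X_def)
      then show "card {x \<in> X. x \<in> B r t} = c r" using insert.prems(4) t by simp
    qed simp
    finally show ?thesis by simp
  qed
  ultimately have lower: "K' * card X + (K - K') * (c r * card T)
      \<le> card (\<Union>t\<in>T. \<Pi>\<^sub>E j\<in>insert r J. B j t)"
    by (simp add: sum.distrib mult.commute[of K'] flip: sum_distrib_left)
  have "c r + e r * (card T - 1) \<le> card X"
    unfolding X_def using insert.prems by auto
  then have "K' * (c r + e r * (card T - 1)) \<le> K' * card X"
    by (rule mult_le_mono2)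
  moreover obtain q where q: "card T = Suc q"
    using insert.prems by (metis card_eq_0_iff not0_implies_Suc)
  moreover have "c r * K + (c r * K - (c r - e r) * K') * q
      = K' * (c r + e r * q) + (K - K') * (c r * Suc q)"
  proof -
    obtain a where a: "K = K' + a" using \<open>K' \<le> K\<close> le_Suc_ex by blast
    obtain b where b: "c r = e r + b" using er le_Suc_ex by blast
    have "(e r + b) * (K' + a) - b * K' = e r * K' + e r * a + b * a"
      by (simp add: algebra_simps)
    then show ?thesis unfolding a b by (simp add: algebra_simps)
  qed
  ultimately have "c r * K + (c r * K - (c r - e r) * K') * (card T - 1)
      \<le> card (\<Union>t\<in>T. \<Pi>\<^sub>E j\<in>insert r J. B j t)"
    using lower unfolding q diff_Suc_1 by linarith
  then show ?case
    by (simp only: prod.insert[OF insert.hyps] K_def K'_def)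
qed

section \<open>The Cauchy--Davenport inequality\<close>

text \<open>Primality of the modulus enters here: every nonzero \<open>d\<close> generates the
additive group, so a nonempty set that is stable under translation by \<open>d\<close> is everything.\<close>

lemma mod_ring_shift_closed_eq_UNIV:
  fixes X :: "'p :: prime_card mod_ring set"
  assumes "X \<noteq> {}" and "d \<noteq> 0" and closed: "\<And>x. x \<in> X \<Longrightarrow> x + d \<in> X"
  shows "X = UNIV"
proof -
  from \<open>X \<noteq> {}\<close> obtain x where x: "x \<in> X" by blast
  have multiple: "x + of_nat i * d \<in> X" for i
  proof (induction i)
    case (Suc i)
    then show ?case using closed[of "x + of_nat i * d"] by (simp add: algebra_simps)
  qed (simp add: x)
  have "z \<in> X" for z
  proof -
    define w where "w = (z - x) / d"
    have "of_int (to_int_mod_ring w) = w"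
      by (simp add: of_int_of_int_mod_ring)
    moreover have "to_int_mod_ring w \<ge> 0"
      using range_to_int_mod_ring[where 'a = 'p] by (metis atLeastLessThan_iff rangeI)
    ultimately have "of_nat (nat (to_int_mod_ring w)) = w"
      by simp
    then have "x + of_nat (nat (to_int_mod_ring w)) * d = z"
      using \<open>d \<noteq> 0\<close> by (simp add: w_def)
    with multiple show ?thesis by metis
  qed
  then show ?thesis by blast
qed

text \<open>Davenport's transform: for a shift \<open>e\<close>, take out of \<open>Y\<close> the elements whose \<open>e\<close>-translate is not in
\<open>X\<close>, and put these translates into \<open>X\<close>.  The sum of the two cardinalities is unchanged and the sumset does
not grow, and \<open>e\<close> can be chosen so that \<open>Y\<close> shrinks without becoming empty.\<close>

theorem cauchy_davenport:
  fixes X Y :: "'p :: prime_card mod_ring set"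
  assumes "X \<noteq> {}" and "Y \<noteq> {}" and "card X + card Y \<le> CARD('p) + 1"
  shows "card X + card Y \<le> card (\<Union>y\<in>Y. (\<lambda>x. x + y) ` X) + 1"
  using assms
proof (induction "card Y" arbitrary: X Y rule: less_induct)
  case less
  show ?case
  proof (cases "card Y \<le> 1 \<or> X = UNIV")
    case True
    from less.prems obtain y where "y \<in> Y" by blast
    then have "(\<lambda>x. x + y) ` X \<subseteq> (\<Union>y\<in>Y. (\<lambda>x. x + y) ` X)" by blast
    then have "card ((\<lambda>x. x + y) ` X) \<le> card (\<Union>y\<in>Y. (\<lambda>x. x + y) ` X)"
      by (intro card_mono) auto
    then have "card X \<le> card (\<Union>y\<in>Y. (\<lambda>x. x + y) ` X)"
      by (simp add: card_image)
    with True less.prems show ?thesis by auto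
  next
    case False
    then obtain y y' where y: "y \<in> Y" "y' \<in> Y" "y \<noteq> y'"
      by (metis card_le_Suc0_iff_eq finite One_nat_def)
    with False mod_ring_shift_closed_eq_UNIV[of X "y' - y"] less.prems
    obtain x where x: "x \<in> X" "x + (y' - y) \<notin> X" by auto
    \<comment> \<open>This shift keeps \<open>y\<close> in \<open>Y'\<close>, since \<open>y + e = x\<close>, and expels \<open>y'\<close>, since \<open>y' + e\<close> is outside \<open>X\<close>.\<close>
    define e where "e = x - y"
    define X' where "X' = X \<union> (\<lambda>z. z + e) ` Y"
    define Y' where "Y' = {z \<in> Y. z + e \<in> X}"
    have Y': "y \<in> Y'" "y' \<notin> Y'" "Y' \<subseteq> Y"
      using x y by (auto simp: Y'_def e_def algebra_simps)
    have cards: "card X' + card Y' = card X + card Y"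
    proof -
      have "card Y' = card ((\<lambda>z. z + e) ` Y')"
        by (simp add: card_image)
      also have "(\<lambda>z. z + e) ` Y' = X \<inter> (\<lambda>z. z + e) ` Y"
        by (auto simp: Y'_def)
      finally show ?thesis
        using card_Un_Int[of X "(\<lambda>z. z + e) ` Y"] by (simp add: X'_def card_image)
    qed
    have "card Y' < card Y"
      using Y' y by (intro psubset_card_mono) auto
    then have "card X' + card Y' \<le> card (\<Union>y\<in>Y'. (\<lambda>x. x + y) ` X') + 1"
    proof (rule less.hyps)
      show "X' \<noteq> {}" "Y' \<noteq> {}"
        using Y' less.prems by (auto simp: X'_def)
      show "card X' + card Y' \<le> CARD('p) + 1"
        using less.prems by (simp add: cards)
    qed
    also have "card (\<Union>y\<in>Y'. (\<lambda>x. x + y) ` X') \<le> card (\<Union>y\<in>Y. (\<lambda>x. x + y) ` X)"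
    proof (intro card_mono subsetI)
      fix w assume "w \<in> (\<Union>y\<in>Y'. (\<lambda>x. x + y) ` X')"
      then obtain u z where w: "w = u + z" and u: "u \<in> X'" and z: "z \<in> Y" "z + e \<in> X"
        by (auto simp: Y'_def)
      show "w \<in> (\<Union>y\<in>Y. (\<lambda>x. x + y) ` X)"
      proof (cases "u \<in> X")
        case False
        then obtain t where t: "t \<in> Y" "u = t + e" using u by (auto simp: X'_def)
        then have "w = (z + e) + t" by (simp add: w algebra_simps)
        with t z show ?thesis by blast
      qed (use w z in blast)
    qed simp
    finally show ?thesis by (simp add: cards)
  qed
qed

section \<open>Unions of translated boxes over the prime field\<close>

lemma card_shifts_lower_bound:
  fixes X T :: "'p :: prime_card mod_ring set" and b :: "'p mod_ring"
  assumes "card X = k" and "X \<noteq> {}" and "T \<noteq> {}" and "k + card T \<le> CARD('p) + 1"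
  shows "k + (if b = 0 then 0 else 1) * (card T - 1) \<le> card (\<Union>t\<in>T. (\<lambda>x. x - b * t) ` X)"
proof (cases "b = 0")
  case True
  then have "(\<Union>t\<in>T. (\<lambda>x. x - b * t) ` X) = X" using \<open>T \<noteq> {}\<close> by auto
  with True assms show ?thesis by simp
next
  case False
  then have "card ((\<lambda>t. - (b * t)) ` T) = card T"
    by (intro card_image) (auto simp: inj_on_def)
  moreover have "(\<Union>t\<in>T. (\<lambda>x. x - b * t) ` X) = (\<Union>y\<in>(\<lambda>t. - (b * t)) ` T. (\<lambda>x. x + y) ` X)"
    by simp
  moreover have "card T > 0"
    using \<open>T \<noteq> {}\<close> by (simp add: card_gt_0_iff)
  ultimately show ?thesis
    using cauchy_davenport[of X "(\<lambda>t. - (b * t)) ` T"] assms False by simp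
qed

text \<open>The boxes for different \<open>t\<close> move only in the directions with \<open>b j \<noteq> 0\<close>, and by Cauchy--Davenport the
growth there is at least one new element for each translate after the first (\<open>e j = 1\<close>); in the other directions all boxes have the
same side (\<open>e j = 0\<close>).  The result is the bound of the main theorem for a kernel vector with
\<open>Suc r\<close> nonzero coordinates, the extra one being the coordinate over which \<open>t\<close> ranges.\<close>

lemma card_union_of_shifted_boxes:
  fixes A :: "nat \<Rightarrow> 'p :: prime_card mod_ring set" and b :: "nat \<Rightarrow> 'p mod_ring"
  assumes "finite J" and "card T = k" and "k \<ge> 1" and "2 * k \<le> CARD('p) + 1"
    and A: "\<And>j. j \<in> J \<Longrightarrow> card (A j) = k"
    and r: "r = card {j \<in> J. b j \<noteq> 0}"
  shows "(k ^ Suc r - (k - 1) ^ Suc r) * k ^ (card J - r)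
    \<le> card (\<Union>t\<in>T. \<Pi>\<^sub>E j\<in>J. (\<lambda>a. a - b j * t) ` A j)"
proof -
  define e where "e j = (if b j = 0 then 0 else 1 :: nat)" for j
  have "T \<noteq> {}" "finite T" using assms(2,3) by auto
  have "r \<le> card J"
    unfolding r using \<open>finite J\<close> by (intro card_mono) auto
  have K': "(\<Prod>j\<in>J. k - e j) = (k - 1) ^ r * k ^ (card J - r)"
  proof -
    have "(\<Prod>j\<in>J. k - e j) = (\<Prod>j\<in>J. if b j \<noteq> 0 then k - 1 else k)"
      by (intro prod.cong) (auto simp: e_def)
    also have "\<dots> = (k - 1) ^ card (J \<inter> {j. b j \<noteq> 0}) * k ^ card (J \<inter> - {j. b j \<noteq> 0})"
      by (simp only: prod.If_cases[OF \<open>finite J\<close>] prod_constant)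
    also have "J \<inter> {j. b j \<noteq> 0} = {j \<in> J. b j \<noteq> 0}" by blast
    also have "J \<inter> - {j. b j \<noteq> 0} = J - {j \<in> J. b j \<noteq> 0}" by blast
    also have "card \<dots> = card J - r"
      unfolding r using \<open>finite J\<close> by (intro card_Diff_subset) auto
    finally show ?thesis by (simp only: r)
  qed
  \<comment> \<open>Purely arithmetic: this is the general bound for boxes with all \<open>c j = k\<close> and \<open>card T = k\<close>.\<close>
  have "(k ^ Suc r - (k - 1) ^ Suc r) * k ^ (card J - r)
      = k ^ card J + (k ^ card J - (k - 1) ^ r * k ^ (card J - r)) * (k - 1)"
  proof -
    define P where "P = k ^ (card J - r)"
    obtain q where q: "k = Suc q" using \<open>k \<ge> 1\<close> by (cases k) auto
    have "(k - 1) ^ r \<le> k ^ r" by (intro power_mono) auto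
    then obtain d where d: "k ^ r = q ^ r + d" using q le_Suc_ex by auto
    have 1: "k ^ card J = k ^ r * P"
      unfolding P_def using \<open>r \<le> card J\<close> by (simp flip: power_add)
    have 2: "k ^ Suc r - (k - 1) ^ Suc r = k ^ r + d * q"
      using d by (simp add: q algebra_simps)
    have 3: "k ^ r * P - (k - 1) ^ r * P = d * P"
      using d by (simp add: q algebra_simps)
    show ?thesis
      unfolding P_def[symmetric] 1 2 3 by (simp add: q algebra_simps)
  qed
  also have "\<dots> = (\<Prod>j\<in>J. k) + ((\<Prod>j\<in>J. k) - (\<Prod>j\<in>J. k - e j)) * (card T - 1)"
    using \<open>card T = k\<close> by (simp add: K')
  also have "\<dots> \<le> card (\<Union>t\<in>T. \<Pi>\<^sub>E j\<in>J. (\<lambda>a. a - b j * t) ` A j)"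
  proof (rule card_union_of_boxes)
    fix j T' assume j: "j \<in> J" and T': "T' \<subseteq> T" "T' \<noteq> {}"
    have "card T' \<le> k"
      using card_mono[OF \<open>finite T\<close> T'(1)] \<open>card T = k\<close> by simp
    then show "k + e j * (card T' - 1) \<le> card (\<Union>t\<in>T'. (\<lambda>a. a - b j * t) ` A j)"
      unfolding e_def using A[OF j] T' assms(3,4)
      by (intro card_shifts_lower_bound) auto
  qed (use assms \<open>T \<noteq> {}\<close> \<open>finite T\<close> in \<open>auto simp: card_image e_def inj_on_def\<close>)
  finally show ?thesis .
qed

section \<open>Linear maps between coordinate spaces\<close>

lemma mem_map_kernel_iff:
  assumes "linear_map class_ring (module_vec TYPE('a :: field) n) (module_vec TYPE('a) m) L"
  shows "w \<in> map_kernel n m L \<longleftrightarrow> w \<in> carrier_vec n \<and> L w = 0\<^sub>v m"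
proof -
  interpret linear_map class_ring "module_vec TYPE('a) n" "module_vec TYPE('a) m" L
    by fact
  show ?thesis by (simp add: map_kernel_def ker_def module_vec_simps)
qed

lemma linear_map_vec_minus_smult:
  assumes "linear_map class_ring (module_vec TYPE('a :: field) n) (module_vec TYPE('a) m) L"
    and "x \<in> carrier_vec n" and "y \<in> carrier_vec n"
  shows "L (x - a \<cdot>\<^sub>v y) = L x - a \<cdot>\<^sub>v L y"
proof -
  interpret linear_map class_ring "module_vec TYPE('a) n" "module_vec TYPE('a) m" L
    by fact
  have carr: "L x \<in> carrier_vec m" "L y \<in> carrier_vec m"
    using assms T_im[of x] T_im[of y] by (auto simp: module_vec_simps)
  have "x - a \<cdot>\<^sub>v y = x + (- a) \<cdot>\<^sub>v y"
    using assms by auto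
  also have "L \<dots> = L x + (- a) \<cdot>\<^sub>v L y"
    using T_add[of x "(- a) \<cdot>\<^sub>v y"] T_smult[of "- a" y] assms
    by (simp add: module_vec_simps class_ring_simps)
  also have "\<dots> = L x - a \<cdot>\<^sub>v L y"
    using carr by auto
  finally show ?thesis .
qed

lemma map_rank_full_imp_surj:
  fixes L :: "'a :: {field, finite} vec \<Rightarrow> 'a vec"
  assumes lin: "linear_map class_ring (module_vec TYPE('a) n) (module_vec TYPE('a) m) L"
    and rank: "map_rank n m L = m"
  shows "L ` carrier_vec n = carrier_vec m"
proof -
  interpret W: vec_space "TYPE('a)" m .
  have hom: "mod_hom class_ring (module_vec TYPE('a) n) (module_vec TYPE('a) m) L"
    using lin by (simp add: linear_map_def)
  define R where "R = mod_hom.im (module_vec TYPE('a) n) L"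
  have R: "R = L ` carrier_vec n"
    by (simp add: R_def mod_hom.im_def[OF hom] module_vec_simps)
  have sub: "VectorSpace.subspace class_ring R (module_vec TYPE('a) m)"
    unfolding R_def by (rule linear_map.imT_is_subspace[OF lin])
  then have submod: "submodule class_ring R (module_vec TYPE('a) m)"
    by (simp add: VectorSpace.subspace_def)
  then have R_carrier: "R \<subseteq> carrier_vec m"
    by (simp add: submodule_def module_vec_simps)
  interpret I: vectorspace class_ring "(module_vec TYPE('a) m)\<lparr>carrier := R\<rparr>"
    by (rule W.subspace_is_vs[OF sub])
  have "finite R" by (rule finite_subset[OF R_carrier finite_carrier_vec])
  then have "I.fin_dim"
    unfolding I.fin_dim_def using I.in_own_span[of R] I.span_is_subset2[of R] by auto
  then obtain B where B: "finite B" "I.basis B"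
    using I.finite_basis_exists by blast
  have BR: "B \<subseteq> R" and Bli: "\<not> I.lin_dep B"
    using B by (auto simp: I.basis_def)
  have "card B = m"
    using I.dim_basis[OF B] rank by (simp add: map_rank_def R_def)
  moreover have "\<not> W.lin_dep B"
    using Bli W.span_li_not_depend(2)[OF BR submod] by simp
  ultimately have "W.basis B"
    using W.dim_li_is_basis[of B] B BR R_carrier W.dim_is_n by auto
  then have "carrier_vec m = W.span B"
    by (simp add: W.basis_def)
  also have "\<dots> \<subseteq> R"
    using W.span_is_subset[OF BR submod] by simp
  finally show ?thesis using R R_carrier by simp
qed

lemma vec_supp_minus_smult_subset:
  fixes x w :: "'a :: field vec"
  assumes "x \<in> carrier_vec n" and "w \<in> carrier_vec n"
    and "vec_supp w \<subseteq> insert j J" and "w $ j \<noteq> 0"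
  shows "vec_supp (x - (x $ j / w $ j) \<cdot>\<^sub>v w) \<subseteq> vec_supp x \<union> J - ({j} - J)"
proof
  fix i assume "i \<in> vec_supp (x - (x $ j / w $ j) \<cdot>\<^sub>v w)"
  then have i: "i < n" "x $ i - (x $ j / w $ j) * w $ i \<noteq> 0"
    using assms by (auto simp: vec_supp_def)
  then show "i \<in> vec_supp x \<union> J - ({j} - J)"
    using assms by (cases "w $ i = 0") (auto simp: vec_supp_def)
qed

text \<open>A kernel vector \<open>w\<close> as in the hypothesis says that column \<open>j\<close> of \<open>L\<close> is a combination of the columns
in \<open>J\<close>.  Subtracting multiples of such vectors clears the coordinates outside \<open>J\<close> one by one.\<close>

lemma linear_image_represented_on:
  fixes L :: "'a :: field vec \<Rightarrow> 'a vec"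
  assumes lin: "linear_map class_ring (module_vec TYPE('a) n) (module_vec TYPE('a) m) L"
    and relation: "\<And>j. j < n \<Longrightarrow> j \<notin> J \<Longrightarrow>
      \<exists>w\<in>map_kernel n m L. w $ j \<noteq> 0 \<and> vec_supp w \<subseteq> insert j J"
    and "x \<in> carrier_vec n"
  shows "\<exists>y\<in>carrier_vec n. vec_supp y \<subseteq> J \<and> L y = L x"
  using \<open>x \<in> carrier_vec n\<close>
proof (induction "card (vec_supp x - J)" arbitrary: x rule: less_induct)
  case less
  show ?case
  proof (cases "vec_supp x \<subseteq> J")
    case False
    then obtain j where j: "j \<in> vec_supp x" "j \<notin> J" by blast
    then have "j < n" using less.prems by (simp add: vec_supp_def)
    with relation j obtain w where w: "w \<in> carrier_vec n" "L w = 0\<^sub>v m" "w $ j \<noteq> 0"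
        "vec_supp w \<subseteq> insert j J"
      unfolding mem_map_kernel_iff[OF lin] Bex_def by blast
    define y where "y = x - (x $ j / w $ j) \<cdot>\<^sub>v w"
    have "vec_supp y - J \<subset> vec_supp x - J"
      using vec_supp_minus_smult_subset[OF less.prems w(1,4,3)] j by (auto simp: y_def)
    then have "card (vec_supp y - J) < card (vec_supp x - J)"
      by (intro psubset_card_mono) (auto simp: vec_supp_def)
    moreover have "y \<in> carrier_vec n"
      using w less.prems by (simp add: y_def)
    moreover have "L y = L x"
    proof -
      interpret linear_map class_ring "module_vec TYPE('a) n" "module_vec TYPE('a) m" L
        by fact
      have "L x \<in> carrier_vec m"
        using T_im[of x] less.prems by (auto simp: module_vec_simps)
      then show ?thesis
        using linear_map_vec_minus_smult[OF lin less.prems w(1)] w by (auto simp: y_def)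
    qed
    ultimately show ?thesis using less.hyps by metis
  qed (use less.prems in blast)
qed

lemma card_vecs_supported_on_le:
  assumes "finite J"
  shows "card {y \<in> carrier_vec n :: 'a :: {zero, finite} vec set. vec_supp y \<subseteq> J} \<le> CARD('a) ^ card J"
proof -
  let ?Y = "{y \<in> carrier_vec n :: 'a vec set. vec_supp y \<subseteq> J}"
  let ?r = "\<lambda>y :: 'a vec. \<lambda>j\<in>J. y $ j"
  have "inj_on ?r ?Y"
  proof (rule inj_onI)
    fix y z :: "'a vec"
    assume y: "y \<in> ?Y" and z: "z \<in> ?Y" and eq: "?r y = ?r z"
    show "y = z"
    proof (rule eq_vecI)
      fix i assume "i < dim_vec z"
      then have i: "i < n" using z by auto
      show "y $ i = z $ i"
      proof (cases "i \<in> J")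
        case True
        then show ?thesis using fun_cong[OF eq, of i] by simp
      next
        case False
        then have "i \<notin> vec_supp y" "i \<notin> vec_supp z" using y z by auto
        then show ?thesis using y z i by (auto simp: vec_supp_def)
      qed
    qed (use y z in auto)
  qed
  then have "card ?Y \<le> card (J \<rightarrow>\<^sub>E (UNIV :: 'a set))"
    by (rule card_inj_on_le) (use assms in \<open>auto intro: finite_PiE\<close>)
  also have "\<dots> = CARD('a) ^ card J"
    using assms by (simp add: card_PiE)
  finally show ?thesis .
qed

text \<open>Independent columns of \<open>L\<close> extend to a basis of the column space, which is the whole
codomain.  Independence of the columns in \<open>J\<close> is expressed by the absence of nonzero kernel vectors
supported in \<open>J\<close>.  For a maximal such \<open>J\<close> the columns in \<open>J\<close> span, and over a finite field the bound
\<open>m \<le> card J\<close> follows by comparing the \<open>CARD('a) ^ m\<close> values of \<open>L\<close> with the number of vectors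
supported in \<open>J\<close>.\<close>

lemma independent_coordinates_extend:
  fixes L :: "'a :: {field, finite} vec \<Rightarrow> 'a vec"
  assumes lin: "linear_map class_ring (module_vec TYPE('a) n) (module_vec TYPE('a) m) L"
    and rank: "map_rank n m L = m"
    and J0: "J0 \<subseteq> {..<n}"
    and indep: "\<And>w. w \<in> map_kernel n m L \<Longrightarrow> vec_supp w \<subseteq> J0 \<Longrightarrow> w = 0\<^sub>v n"
  obtains J where "J0 \<subseteq> J" and "J \<subseteq> {..<n}" and "m \<le> card J"
    and "\<And>w. w \<in> map_kernel n m L \<Longrightarrow> vec_supp w \<subseteq> J \<Longrightarrow> w = 0\<^sub>v n"
proof -
  define \<I> where "\<I> = {J. J \<subseteq> {..<n} \<and> (\<forall>w\<in>map_kernel n m L. vec_supp w \<subseteq> J \<longrightarrow> w = 0\<^sub>v n)}"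
  have "finite \<I>"
    by (rule finite_subset[of _ "Pow {..<n}"]) (auto simp: \<I>_def)
  moreover have "J0 \<in> \<I>"
    using J0 indep by (auto simp: \<I>_def)
  ultimately obtain J where J: "J \<in> \<I>" "J0 \<subseteq> J" and maximal: "\<forall>J'\<in>\<I>. J \<subseteq> J' \<longrightarrow> J = J'"
    using finite_has_maximal2[of \<I> J0] by blast
  have fin: "finite J"
    using J by (auto simp: \<I>_def intro: finite_subset)
  have relation: "\<exists>w\<in>map_kernel n m L. w $ j \<noteq> 0 \<and> vec_supp w \<subseteq> insert j J"
    if j: "j < n" "j \<notin> J" for j
  proof -
    have "insert j J \<notin> \<I>" using maximal j by blast
    then obtain w where w: "w \<in> map_kernel n m L" "vec_supp w \<subseteq> insert j J" "w \<noteq> 0\<^sub>v n"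
      using J j by (auto simp: \<I>_def)
    moreover have "w $ j \<noteq> 0"
    proof
      assume "w $ j = 0"
      then have "vec_supp w \<subseteq> J" using w by (auto simp: vec_supp_def)
      then show False using J w by (auto simp: \<I>_def)
    qed
    ultimately show ?thesis by blast
  qed
  let ?Y = "{y \<in> carrier_vec n :: 'a vec set. vec_supp y \<subseteq> J}"
  have "carrier_vec m \<subseteq> L ` ?Y"
  proof
    fix z :: "'a vec" assume "z \<in> carrier_vec m"
    then have "z \<in> L ` carrier_vec n"
      by (simp only: map_rank_full_imp_surj[OF lin rank])
    then obtain x where x: "x \<in> carrier_vec n" and z: "z = L x"
      by (rule imageE)
    obtain y where "y \<in> carrier_vec n" "vec_supp y \<subseteq> J" "L y = L x"
      using linear_image_represented_on[OF lin relation x] by auto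
    then show "z \<in> L ` ?Y"
      unfolding z by (intro image_eqI[of _ _ y]) auto
  qed
  then have "card (carrier_vec m :: 'a vec set) \<le> card (L ` ?Y)"
    by (intro card_mono) auto
  also have "\<dots> \<le> card ?Y"
    by (intro card_image_le) auto
  also have "\<dots> \<le> CARD('a) ^ card J"
    by (rule card_vecs_supported_on_le[OF fin])
  finally have "CARD('a) ^ m \<le> CARD('a) ^ card J"
    by (simp add: card_carrier_vec)
  moreover have "1 < CARD('a)"
    using card_mono[of UNIV "{0, 1 :: 'a}"] by simp
  ultimately have "m \<le> card J" by simp
  with J show thesis by (intro that[of J]) (auto simp: \<I>_def)
qed

section \<open>From boxes to linear images\<close>

lemma finite_vec_box:
  "finite (vec_box n A :: 'a :: finite vec set)"
  by (rule finite_subset[of _ "carrier_vec n"]) (auto simp: vec_box_def)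

text \<open>Fix the coordinates outside \<open>insert l J\<close>.  Two vectors that agree there have the same image under
\<open>L\<close> only if they differ by a multiple of \<open>v\<close>, because subtracting from their difference the multiple that clears
coordinate \<open>l\<close> leaves a kernel vector supported in \<open>J\<close>.  Hence the reduced vector,
obtained by clearing coordinate \<open>l\<close> with a multiple of \<open>v\<close> and reading off the coordinates in \<open>J\<close>,
is a function of the image.  The reduced vectors with \<open>x $ l = t\<close> form the translated box for \<open>t\<close>.\<close>

lemma card_shifted_boxes_le_card_linear_image:
  fixes L :: "'a :: {field, finite} vec \<Rightarrow> 'a vec"
  assumes lin: "linear_map class_ring (module_vec TYPE('a) n) (module_vec TYPE('a) m) L"
    and v: "v \<in> map_kernel n m L" and l: "l < n" "v $ l \<noteq> 0" "l \<notin> J"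
    and vJ: "vec_supp v \<subseteq> insert l J" and J: "J \<subseteq> {..<n}"
    and indep: "\<And>w. w \<in> map_kernel n m L \<Longrightarrow> vec_supp w \<subseteq> J \<Longrightarrow> w = 0\<^sub>v n"
    and A: "\<And>i. i < n \<Longrightarrow> A i \<noteq> {}"
  shows "card (\<Union>t\<in>A l. \<Pi>\<^sub>E j\<in>J. (\<lambda>a. a - v $ j / v $ l * t) ` A j) \<le> card (L ` vec_box n A)"
    (is "card ?U \<le> _")
proof -
  have vn: "v \<in> carrier_vec n" and Lv: "L v = 0\<^sub>v m"
    using v by (auto simp: mem_map_kernel_iff[OF lin])
  define d where "d i = (SOME a. a \<in> A i)" for i
  have d: "d i \<in> A i" if "i < n" for i
    using A[OF that] by (simp add: d_def some_in_eq)
  define red where "red x = (\<lambda>j\<in>J. x $ j - v $ j / v $ l * x $ l)" for x :: "'a vec"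
  define Z where "Z = {x \<in> vec_box n A. \<forall>i<n. i \<notin> insert l J \<longrightarrow> x $ i = d i}"
  have "?U \<subseteq> red ` Z"
  proof
    fix f assume "f \<in> ?U"
    then obtain t where t: "t \<in> A l" "f \<in> (\<Pi>\<^sub>E j\<in>J. (\<lambda>a. a - v $ j / v $ l * t) ` A j)"
      by blast
    define g where "g i = (if i = l then t else if i \<in> J then f i + v $ i / v $ l * t else d i)" for i
    have "g i \<in> A i" if "i < n" for i
      using t d[OF that] by (auto simp: g_def PiE_iff)
    then have "vec n g \<in> Z"
      by (auto simp: Z_def vec_box_def g_def)
    moreover have "red (vec n g) = f"
    proof
      fix j
      show "red (vec n g) j = f j"
        using t J l by (cases "j \<in> J") (auto simp: red_def g_def PiE_iff extensional_def)
    qed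
    ultimately show "f \<in> red ` Z" by blast
  qed
  have inj: "red x = red y" if x: "x \<in> Z" and y: "y \<in> Z" and eq: "L x = L y" for x y
  proof -
    have xn: "x \<in> carrier_vec n" and yn: "y \<in> carrier_vec n"
      using x y by (auto simp: Z_def vec_box_def)
    define c where "c = (x $ l - y $ l) / v $ l"
    \<comment> \<open>The factor 1 gives \<open>x - y\<close> the shape to which linearity is applied.\<close>
    define w where "w = (x - 1 \<cdot>\<^sub>v y) - c \<cdot>\<^sub>v v"
    have w_index: "w $ i = x $ i - y $ i - c * v $ i" if "i < n" for i
      using that xn yn vn by (simp add: w_def)
    have "L y \<in> carrier_vec m"
    proof -
      interpret linear_map class_ring "module_vec TYPE('a) n" "module_vec TYPE('a) m" L
        by fact
      show ?thesis using T_im[of y] yn by (auto simp: module_vec_simps)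
    qed
    moreover have "L w = (L x - 1 \<cdot>\<^sub>v L y) - c \<cdot>\<^sub>v L v"
      unfolding w_def using xn yn vn
      by (simp only: linear_map_vec_minus_smult[OF lin] minus_carrier_vec smult_carrier_vec)
    ultimately have "L w = 0\<^sub>v m"
      unfolding eq Lv by auto
    then have "w \<in> map_kernel n m L"
      using xn yn vn by (simp add: mem_map_kernel_iff[OF lin] w_def)
    moreover have "vec_supp w \<subseteq> J"
    proof
      fix i assume "i \<in> vec_supp w"
      then have i: "i < n" "w $ i \<noteq> 0"
        using xn yn vn by (auto simp: vec_supp_def w_def)
      have "i \<noteq> l"
        using i l by (auto simp: w_index c_def)
      moreover have "i \<in> insert l J"
      proof (rule ccontr)
        assume out: "i \<notin> insert l J"
        then have "v $ i = 0" using vJ vn i by (auto simp: vec_supp_def)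
        moreover have "x $ i = y $ i" using x y i out by (auto simp: Z_def)
        ultimately show False using i by (simp add: w_index)
      qed
      ultimately show "i \<in> J" by blast
    qed
    ultimately have "w = 0\<^sub>v n" by (rule indep)
    show ?thesis
    proof
      fix j
      show "red x j = red y j"
      proof (cases "j \<in> J")
        case True
        then have "j < n" using J by auto
        then have "x $ j - y $ j - c * v $ j = 0"
          using \<open>w = 0\<^sub>v n\<close> w_index by fastforce
        then have "x $ j = y $ j + c * v $ j"
          by (simp add: algebra_simps)
        with True l show ?thesis
          by (simp add: red_def c_def field_simps)
      qed (simp add: red_def)
    qed
  qed
  have "finite Z" unfolding Z_def using finite_vec_box by (rule rev_finite_subset) auto
  have "card ?U \<le> card (red ` Z)"
    by (rule card_mono) (use \<open>?U \<subseteq> red ` Z\<close> \<open>finite Z\<close> in auto)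
  \<comment> \<open>On \<open>Z\<close> the reduced vector is a function of the image under \<open>L\<close>; a choice of preimages realises it.\<close>
  also have "red ` Z = (\<lambda>z. red (SOME x. x \<in> Z \<and> L x = z)) ` L ` Z"
  proof -
    have "red x = red (SOME x'. x' \<in> Z \<and> L x' = L x)" if "x \<in> Z" for x
    proof -
      have "(SOME x'. x' \<in> Z \<and> L x' = L x) \<in> Z \<and> L (SOME x'. x' \<in> Z \<and> L x' = L x) = L x"
        by (rule someI[of _ x]) (use that in simp)
      then show ?thesis using inj[OF that] by metis
    qed
    then show ?thesis by (simp add: image_image cong: image_cong_simp)
  qed
  also have "card \<dots> \<le> card (L ` Z)"
    by (rule card_image_le) (use \<open>finite Z\<close> in simp)
  also have "\<dots> \<le> card (L ` vec_box n A)"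
    by (rule card_mono) (use finite_vec_box in \<open>auto simp: Z_def\<close>)
  finally show ?thesis .
qed

section \<open>The lower bound for linear images of boxes\<close>

theorem theorem1p1:
  fixes L :: "'p :: prime_card mod_ring vec \<Rightarrow> 'p mod_ring vec"
    and v :: "'p mod_ring vec"
    and A :: "nat \<Rightarrow> 'p mod_ring set"
    and m n s k :: nat
  assumes "m < n"
    and "linear_map class_ring (module_vec TYPE('p mod_ring) n) (module_vec TYPE('p mod_ring) m) L"
    and "map_rank n m L = m"
    and "v \<in> map_kernel n m L" and "v \<noteq> 0\<^sub>v n"
    and "has_minimal_support (map_kernel n m L) v"
    and "s = card (vec_supp v)"
    and "k \<ge> 1" and "CARD('p) \<ge> 2 * k - 1"
    and "\<And>i. i < n \<Longrightarrow> card (A i) = k"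
  shows "card (L ` vec_box n A) \<ge> (k ^ s - (k - 1) ^ s) * k ^ (m + 1 - s)"
proof -
  note lin = assms(2)
  have vn: "v \<in> carrier_vec n"
    using assms(4) by (simp add: mem_map_kernel_iff[OF lin])
  have "vec_supp v \<noteq> {}"
  proof
    assume "vec_supp v = {}"
    then have "v = 0\<^sub>v n" using vn by (auto simp: vec_supp_def)
    with assms(5) show False by simp
  qed
  then obtain l where l: "l \<in> vec_supp v" by blast
  then have ln: "l < n" "v $ l \<noteq> 0" using vn by (auto simp: vec_supp_def)
  have fin: "finite (vec_supp v)" by (simp add: vec_supp_def)
  have minimal: "w = 0\<^sub>v n" if "w \<in> map_kernel n m L" "vec_supp w \<subseteq> vec_supp v - {l}" for w
  proof -
    have "dim_vec w = n" using that by (simp add: mem_map_kernel_iff[OF lin])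
    moreover have "vec_supp w \<subset> vec_supp v" using that l by blast
    ultimately show ?thesis
      using assms(6) that(1) by (auto simp: has_minimal_support_def)
  qed
  \<comment> \<open>Minimality of the support means that the columns of \<open>L\<close> in the support of \<open>v\<close> other than
    column \<open>l\<close> are independent.  The relation \<open>v\<close> keeps \<open>l\<close> out of every independent extension.\<close>
  obtain J where J: "vec_supp v - {l} \<subseteq> J" "J \<subseteq> {..<n}" "m \<le> card J"
    and indep: "\<And>w. w \<in> map_kernel n m L \<Longrightarrow> vec_supp w \<subseteq> J \<Longrightarrow> w = 0\<^sub>v n"
    by (rule independent_coordinates_extend[OF lin assms(3), of "vec_supp v - {l}"])
      (use vn minimal in \<open>auto simp: vec_supp_def\<close>)
  have "l \<notin> J"
    using indep[OF assms(4)] J(1) assms(5) by auto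
  define b where "b j = v $ j / v $ l" for j
  have "finite J" using J(2) finite_subset by auto
  have "{j \<in> J. b j \<noteq> 0} = vec_supp v - {l}"
    using J(1,2) \<open>l \<notin> J\<close> vn ln by (auto simp: b_def vec_supp_def)
  then have r: "card {j \<in> J. b j \<noteq> 0} = s - 1"
    using l fin assms(7) by simp
  have "s \<ge> 1"
    using l fin assms(7) by (auto simp: Suc_le_eq card_gt_0_iff)
  \<comment> \<open>From here on \<open>card J\<close> takes the role of \<open>m\<close>, which only enlarges the bound.\<close>
  have "(k ^ s - (k - 1) ^ s) * k ^ (m + 1 - s) \<le> (k ^ s - (k - 1) ^ s) * k ^ (card J + 1 - s)"
    using J(3) \<open>k \<ge> 1\<close> by (intro mult_le_mono2 power_increasing) auto
  also have "\<dots> = (k ^ Suc (s - 1) - (k - 1) ^ Suc (s - 1)) * k ^ (card J - (s - 1))"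
    using \<open>s \<ge> 1\<close> by simp
  also have "\<dots> \<le> card (\<Union>t\<in>A l. \<Pi>\<^sub>E j\<in>J. (\<lambda>a. a - b j * t) ` A j)"
    using \<open>finite J\<close> J(2) assms(8-10) ln r
    by (intro card_union_of_shifted_boxes) auto
  also have "\<dots> \<le> card (L ` vec_box n A)"
    unfolding b_def
  proof (rule card_shifted_boxes_le_card_linear_image[OF lin assms(4) ln \<open>l \<notin> J\<close> _ J(2) indep])
    show "A i \<noteq> {}" if "i < n" for i
      using assms(8) assms(10)[OF that] by auto
  qed (use J(1) in auto)
  finally show ?thesis .
qed

end
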